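(* Let $n\ge 1$, let $B_k\in\mathbb{R}^{n\times n}$ be symmetric positive definite, and let $y_k,s_k\in\mathbb{R}^n$ satisfy $y_k^Ts_k>0$. Then a solution $B^*$ of $$\min_{\{B=B^T,\;B>0\}}\ \mathbb{D}\left(B^{-1}\,\|\,B_k^{-1}\right)\quad\text{subject to}\quad B^{-1}y_k=s_k$$ is given by the standard BFGS iteration $B^*=B_{k+1}$, where $$B_{k+1}^{-1}=\left(I_n-\frac{y_ks_k^T}{y_k^Ts_k}\right)^TB_k^{-1}\left(I_n-\frac{y_ks_k^T}{y_k^Ts_k}\right)+\frac{s_ks_k^T}{y_k^Ts_k}.$$
   Context: For symmetric positive definite $n\times n$ real matrices $P,Q$, the relative entropy between the zero-mean Gaussian distributions with covariances $P$ and $Q$ is written in terms of the inverse matrices as $$\mathbb{D}(P^{-1}\|Q^{-1})=\frac12\left[\log\det(P^{-1}Q)+\operatorname{trace}(Q^{-1}P)-n\right].$$ Here $B>0$ means that $B$ is positive definite; the minimization is over all symmetric positive definite $n\times n$ real matrices $B$ satisfying the constraint. *)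

theory Defs
  imports "HOL-Analysis.Analysis"
begin

definition spd :: "real ^ 'n ^ 'n \<Rightarrow> bool" where
  "spd A \<longleftrightarrow> transpose A = A \<and> (\<forall>x. x \<noteq> 0 \<longrightarrow> x \<bullet> (A *v x) > 0)"

(* gauss_rel_entropy P Q is D(P^-1 || Q^-1): the arguments are the covariances P and Q
   themselves, not their inverses. *)
definition gauss_rel_entropy :: "real ^ 'n ^ 'n \<Rightarrow> real ^ 'n ^ 'n \<Rightarrow> real" where
  "gauss_rel_entropy P Q =
     1 / 2 * (ln (det (matrix_inv P ** Q)) + trace (matrix_inv Q ** P) - real CARD('n))"

(* u v^T, with u an n x 1 and v^T a 1 x n matrix *)
definition outer_prod :: "real ^ 'n \<Rightarrow> real ^ 'n \<Rightarrow> real ^ 'n ^ 'n" where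
  "outer_prod u v = (columnvector u :: real ^ 1 ^ 'n) ** (rowvector v :: real ^ 'n ^ 1)"

(* The BFGS formula gives the inverse of the updated matrix. *)
definition bfgs_inverse ::
    "real ^ 'n ^ 'n \<Rightarrow> real ^ 'n \<Rightarrow> real ^ 'n \<Rightarrow> real ^ 'n ^ 'n" where
  "bfgs_inverse B y s =
     transpose (mat 1 - (1 / (y \<bullet> s)) *\<^sub>R outer_prod y s) ** matrix_inv B **
       (mat 1 - (1 / (y \<bullet> s)) *\<^sub>R outer_prod y s)
     + (1 / (y \<bullet> s)) *\<^sub>R outer_prod s s"

end

theory Submission
  imports Defs
begin

(* Convexity gives ln det (P ** Q) \<le> trace (P ** Q) - n for positive definite P and Q,
   by simultaneous reduction to the scalar inequality ln d \<le> d - 1. Hence the objective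
   at a feasible B exceeds its value at the BFGS matrix B' by at least half the trace of
   (H - H') ** (B - B'), where H and H' are the inverses of B\<^sub>k and B'. Feasibility reads
   B s = y = B' s, so D = B - B' annihilates s; with W = I - y s^T / (y . s) this
   yields W D = D = D W^T, and the trace vanishes since H' = W^T H W + s s^T / (y . s). *)

section \<open>Spectral theorem for real symmetric matrices\<close>

text \<open>For small \<open>t\<close> of sign opposite to \<open>b\<close> the linear term would
  dominate and make the value negative. This is the first-order condition at a maximiser of the
  Rayleigh quotient.\<close>

lemma linear_coeff_zero_of_quadratic_nonneg:
  fixes b c :: real
  assumes "\<And>t. 0 \<le> b * t + c * t^2"
  shows "b = 0"
proof (rule ccontr)
  assume "b \<noteq> 0"
  \<comment> \<open>Any positive \<open>k\<close> exceeding \<open>c\<close> works: at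
    \<open>- b / k\<close> the quadratic equals \<open>b^2 / k^2\<close> times the negative number
    \<open>c - k\<close>.\<close>
  define k where "k = \<bar>c\<bar> + 1"
  have k: "k > 0" "c < k" by (auto simp: k_def)
  have "b * (- b / k) + c * (- b / k)^2 = (b^2 / k^2) * (c - k)"
    using k by (simp add: field_simps power2_eq_square)
  also have "\<dots> < 0"
    using k \<open>b \<noteq> 0\<close> by (intro mult_pos_neg) auto
  finally show False using assms[of "- b / k"] by simp
qed

lemma inner_symmetric_matrix:
  fixes A :: "real ^ 'n ^ 'n"
  assumes "transpose A = A"
  shows "x \<bullet> (A *v y) = (A *v x) \<bullet> y"
  by (metis assms dot_lmul_matrix transpose_matrix_vector)

text \<open>A maximiser of the Rayleigh quotient on an invariant subspace is an eigenvector.\<close>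

lemma symmetric_eigenvector_in_subspace:
  fixes A :: "real ^ 'n ^ 'n"
  assumes sym: "transpose A = A" and S: "subspace S"
    and inv: "\<And>x. x \<in> S \<Longrightarrow> A *v x \<in> S" and nontrivial: "\<exists>x\<in>S. x \<noteq> 0"
  obtains v l where "v \<in> S" "norm v = 1" "A *v v = l *\<^sub>R v"
proof -
  let ?K = "S \<inter> sphere 0 1"
  obtain x where x: "x \<in> S" "x \<noteq> 0" using nontrivial by auto
  then have "(1 / norm x) *\<^sub>R x \<in> ?K"
    using S by (auto intro: subspace_scale)
  then have "?K \<noteq> {}" by blast
  moreover have "compact ?K"
    using closed_subspace[OF S] by (simp add: closed_Int_compact)
  moreover have "continuous_on ?K (\<lambda>x. x \<bullet> (A *v x))"
    by (intro continuous_intros matrix_vector_mult_linear_continuous_on)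
  ultimately obtain v where v: "v \<in> ?K"
    and max: "\<And>x. x \<in> ?K \<Longrightarrow> x \<bullet> (A *v x) \<le> v \<bullet> (A *v v)"
    using continuous_attains_sup[of ?K "\<lambda>x. x \<bullet> (A *v x)"] by blast
  define l where "l = v \<bullet> (A *v v)"
  have vS: "v \<in> S" and nv: "norm v = 1" using v by auto
  \<comment> \<open>Homogeneity extends the maximum on the unit sphere of \<open>S\<close> to all of
    \<open>S\<close>, with equality at \<open>v\<close>.\<close>
  have le: "x \<bullet> (A *v x) \<le> l * (x \<bullet> x)" if "x \<in> S" for x
  proof (cases "x = 0")
    case False
    have "(1 / norm x) *\<^sub>R x \<in> ?K"
      using S that False by (auto intro: subspace_scale)
    from max[OF this] have "(x \<bullet> (A *v x)) / (norm x)^2 \<le> l"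
      by (simp add: l_def matrix_vector_mult_scaleR power2_eq_square)
    then show ?thesis
      using False by (simp add: power2_norm_eq_inner[symmetric] field_simps)
  qed simp
  \<comment> \<open>The eigenvalue residual, which invariance keeps in \<open>S\<close>. Moving from
    \<open>v\<close> in this direction, the nonnegative gap in \<open>le\<close> starts at 0 and has
    linear coefficient \<open>2 * (w \<bullet> w)\<close>, so \<open>w\<close> must vanish.\<close>
  define w where "w = l *\<^sub>R v - A *v v"
  have wS: "w \<in> S" using S inv vS by (simp add: w_def subspace_diff subspace_scale)
  have "0 \<le> (2 * (w \<bullet> w)) * t + (l * (w \<bullet> w) - w \<bullet> (A *v w)) * t^2" for t
  proof -
    have "v + t *\<^sub>R w \<in> S" using S vS wS by (simp add: subspace_add subspace_scale)
    from le[OF this]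
    have "0 \<le> l * ((v + t *\<^sub>R w) \<bullet> (v + t *\<^sub>R w)) - (v + t *\<^sub>R w) \<bullet> (A *v (v + t *\<^sub>R w))"
      by simp
    also have "\<dots> = l * (v \<bullet> v) - v \<bullet> (A *v v) + 2 * t * (w \<bullet> (l *\<^sub>R v - A *v v))
        + (l * (w \<bullet> w) - w \<bullet> (A *v w)) * t^2"
      using inner_symmetric_matrix[OF sym, of v w]
      by (simp add: matrix_vector_right_distrib matrix_vector_mult_scaleR inner_left_distrib
          inner_right_distrib inner_diff_right algebra_simps power2_eq_square inner_commute)
    also have "\<dots> = (2 * (w \<bullet> w)) * t + (l * (w \<bullet> w) - w \<bullet> (A *v w)) * t^2"
      using nv unfolding w_def[symmetric] by (simp add: l_def norm_eq_1)
    finally show ?thesis .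
  qed
  then have "w = 0"
    using linear_coeff_zero_of_quadratic_nonneg by fastforce
  then show ?thesis using that[OF vS nv, of l] by (simp add: w_def)
qed

text \<open>An orthonormal set of eigenvectors of maximal cardinality must span: otherwise its
  orthogonal complement is a nonzero invariant subspace and contributes one more
  eigenvector.\<close>

lemma symmetric_orthonormal_eigenbasis:
  fixes A :: "real ^ 'n ^ 'n"
  assumes sym: "transpose A = A"
  obtains E where "pairwise orthogonal E" "\<And>e. e \<in> E \<Longrightarrow> norm e = 1"
    "\<And>e. e \<in> E \<Longrightarrow> \<exists>l. A *v e = l *\<^sub>R e" "card E = CARD('n)"
proof -
  define good where "good E \<longleftrightarrow> pairwise orthogonal E \<and> (\<forall>e\<in>E. norm e = 1) \<and>
    (\<forall>e\<in>E. \<exists>l. A *v e = l *\<^sub>R e)" for E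
  have ind: "independent E" if "good E" for E
    using that by (intro pairwise_orthogonal_independent) (auto simp: good_def)
  have "good {}" by (simp add: good_def)
  moreover have "\<forall>E. good E \<longrightarrow> card E < Suc (CARD('n))"
    using independent_bound[OF ind] by (auto simp: less_Suc_eq_le)
  ultimately obtain E where E: "good E" and max: "\<And>F. good F \<Longrightarrow> card F \<le> card E"
    using ex_has_greatest_nat[of good "{}" card] by blast
  have fin: "finite E" using independent_bound[OF ind[OF E]] by simp
  let ?S = "{x. \<forall>e\<in>E. orthogonal e x}"
  have "span E = UNIV"
  proof (rule ccontr)
    assume "span E \<noteq> UNIV"
    then obtain a where a: "a \<noteq> 0" "span E \<subseteq> {x. a \<bullet> x = 0}"
      using span_not_univ_subset_hyperplane by blast
    have "orthogonal e a" if "e \<in> E" for e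
      using a(2) span_base[OF that] by (auto simp: orthogonal_def inner_commute[of e])
    with a(1) have aS: "a \<in> ?S" "a \<noteq> 0" by auto
    have "subspace ?S"
      by (auto simp: subspace_def orthogonal_def inner_right_distrib)
    moreover have "A *v x \<in> ?S" if "x \<in> ?S" for x
    proof -
      have "e \<bullet> (A *v x) = 0" if "e \<in> E" for e
      proof -
        obtain l where "A *v e = l *\<^sub>R e" using E \<open>e \<in> E\<close> by (auto simp: good_def)
        then show ?thesis using \<open>x \<in> ?S\<close> \<open>e \<in> E\<close>
          by (simp add: inner_symmetric_matrix[OF sym] orthogonal_def)
      qed
      then show ?thesis by (simp add: orthogonal_def)
    qed
    ultimately obtain v l where v: "v \<in> ?S" "norm v = 1" "A *v v = l *\<^sub>R v"
      using symmetric_eigenvector_in_subspace[OF sym, of ?S] aS by blast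
    \<comment> \<open>A member of \<open>E\<close> lying in \<open>?S\<close> would be orthogonal to
      itself, against unit norm.\<close>
    have "v \<notin> E" using v by (auto simp: orthogonal_def norm_eq_1)
    moreover have "good (insert v E)"
      using E v unfolding good_def
      by (auto simp: pairwise_insert orthogonal_commute)
    ultimately show False using max[of "insert v E"] fin by simp
  qed
  then have "card E = CARD('n)"
    using dim_span_eq_card_independent[OF ind[OF E]] by simp
  with E that show ?thesis by (auto simp: good_def)
qed

section \<open>Diagonal matrices and orthogonal diagonalization\<close>

definition diag_matrix :: "('n \<Rightarrow> real) \<Rightarrow> real ^ 'n ^ 'n" where
  "diag_matrix d = (\<chi> i j. if i = j then d i else 0)"

lemma det_diag_matrix: "det (diag_matrix d) = (\<Prod>i\<in>UNIV. d i)"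
  by (subst det_diagonal) (auto simp: diag_matrix_def)

lemma trace_diag_matrix: "trace (diag_matrix d) = (\<Sum>i\<in>UNIV. d i)"
  by (simp add: trace_def diag_matrix_def)

lemma transpose_diag_matrix [simp]: "transpose (diag_matrix d) = diag_matrix d"
  by (auto simp: transpose_def diag_matrix_def vec_eq_iff)

lemma diag_matrix_mult: "diag_matrix d ** diag_matrix e = diag_matrix (\<lambda>i. d i * e i)"
proof -
  \<comment> \<open>Both conditions are recast with the test \<open>k = i\<close> outermost, so that
    the sum over \<open>k\<close> in the product collapses to one term.\<close>
  have "(if i = k then d i else 0) * (if k = j then e k else 0) =
      (if k = i then if i = j then d i * e i else 0 else 0)" for i j k
    by simp
  then show ?thesis
    by (simp add: matrix_matrix_mult_def diag_matrix_def vec_eq_iff)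
qed

theorem symmetric_matrix_diagonalization:
  fixes A :: "real ^ 'n ^ 'n"
  assumes sym: "transpose A = A"
  obtains Q d where "orthogonal_matrix Q" "A = Q ** diag_matrix d ** transpose Q"
proof -
  obtain E where E: "pairwise orthogonal E" "\<And>e. e \<in> E \<Longrightarrow> norm e = 1"
    "\<And>e. e \<in> E \<Longrightarrow> \<exists>l. A *v e = l *\<^sub>R e" "card E = CARD('n)"
    using symmetric_orthonormal_eigenbasis[OF sym] by blast
  \<comment> \<open>An infinite set has \<open>card\<close> 0, whereas \<open>CARD('n)\<close> is
    positive.\<close>
  then have "finite E" by (metis card.infinite zero_less_card_finite less_irrefl)
  then obtain f where f: "bij_betw f (UNIV :: 'n set) E"
    using finite_same_card_bij[of "UNIV :: 'n set" E] E(4) by auto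
  then have fE: "f i \<in> E" for i by (auto simp: bij_betw_def)
  then have "\<forall>i. \<exists>l. A *v f i = l *\<^sub>R f i" using E(3) by blast
  then obtain d where d: "A *v f i = d i *\<^sub>R f i" for i by (auto dest!: choice)
  \<comment> \<open>The columns of \<open>Q\<close> are the eigenvectors, so
    \<open>A ** Q = Q ** diag_matrix d\<close> is the eigenvalue equation read column by
    column.\<close>
  define Q :: "real ^ 'n ^ 'n" where "Q = (\<chi> i j. f j $ i)"
  have "orthogonal (f i) (f j)" if "i \<noteq> j" for i j
  proof -
    have "f i \<noteq> f j" using f that by (auto simp: bij_betw_def inj_on_def)
    then show ?thesis using E(1) fE by (simp add: pairwise_def)
  qed
  then have Q: "orthogonal_matrix Q"
    using E(2) fE by (simp add: orthogonal_matrix_orthonormal_columns column_def Q_def)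
  have "A ** Q = Q ** diag_matrix d"
  proof -
    have "(A ** Q) $ i $ j = (A *v f j) $ i" for i j
      by (simp add: matrix_matrix_mult_def matrix_vector_mult_def Q_def)
    moreover have "(Q ** diag_matrix d) $ i $ j = d j * f j $ i" for i j
      by (simp add: matrix_matrix_mult_def Q_def diag_matrix_def if_distrib mult.commute
          cong: if_cong)
    ultimately show ?thesis by (simp add: vec_eq_iff d)
  qed
  then have "A = Q ** diag_matrix d ** transpose Q"
    using Q by (metis matrix_mul_assoc matrix_mul_rid orthogonal_matrix_def)
  with Q that show ?thesis by blast
qed

section \<open>Positive definite matrices\<close>

text \<open>A right inverse of a square matrix is also a left inverse, so it agrees with the inverse
  picked by the choice operator in \<open>matrix_inv\<close>.\<close>

lemma matrix_inv_unique:
  fixes A :: "real ^ 'n ^ 'n"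
  assumes "A ** X = mat 1"
  shows "matrix_inv A = X"
proof -
  have X: "X ** A = mat 1" using assms matrix_left_right_inverse by blast
  then have "A ** matrix_inv A = mat 1"
    unfolding matrix_inv_def using assms by (metis (mono_tags, lifting) someI_ex)
  then show ?thesis by (metis X matrix_mul_assoc matrix_mul_lid matrix_mul_rid)
qed

lemma matrix_inv_mult:
  fixes A :: "real ^ 'n ^ 'n"
  assumes "invertible A"
  shows "A ** matrix_inv A = mat 1" "matrix_inv A ** A = mat 1"
  using assms matrix_inv_unique unfolding invertible_def by metis+

lemma inner_congruence:
  fixes A R :: "real ^ 'n ^ 'n"
  shows "x \<bullet> ((transpose R ** A ** R) *v x) = (R *v x) \<bullet> (A *v (R *v x))"
proof -
  have "x \<bullet> (transpose R *v z) = (R *v x) \<bullet> z" for z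
    by (simp add: dot_lmul_matrix[symmetric] inner_commute[of x] inner_commute[of _ z])
  then show ?thesis
    by (simp add: matrix_vector_mul_assoc[symmetric] del: transpose_matrix_vector)
qed

lemma spd_congruence:
  fixes A R :: "real ^ 'n ^ 'n"
  assumes "spd A" "invertible R"
  shows "spd (transpose R ** A ** R)"
proof -
  have "transpose (transpose R ** A ** R) = transpose R ** A ** R"
    using assms by (simp add: spd_def matrix_transpose_mul matrix_mul_assoc)
  moreover have "x \<bullet> ((transpose R ** A ** R) *v x) > 0" if "x \<noteq> 0" for x
  proof -
    have "R *v x \<noteq> 0"
      using that inj_matrix_vector_mult[OF assms(2)] by (metis injD matrix_vector_mult_0_right)
    then show ?thesis using assms(1) by (simp add: inner_congruence spd_def)
  qed
  ultimately show ?thesis by (simp add: spd_def)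
qed

text \<open>The diagonal matrix is congruent to \<open>A\<close> through \<open>Q\<close>, hence
  positive definite; its quadratic form at the \<open>i\<close>-th basis vector is
  \<open>d i\<close>.\<close>

lemma spd_diagonalization:
  fixes A :: "real ^ 'n ^ 'n"
  assumes "spd A"
  obtains Q d where "orthogonal_matrix Q" "A = Q ** diag_matrix d ** transpose Q" "\<And>i. d i > 0"
proof -
  obtain Q d where Q: "orthogonal_matrix Q" and A: "A = Q ** diag_matrix d ** transpose Q"
    using symmetric_matrix_diagonalization assms unfolding spd_def by metis
  have "transpose Q ** A ** Q = (transpose Q ** Q) ** diag_matrix d ** (transpose Q ** Q)"
    by (simp add: A matrix_mul_assoc)
  also have "\<dots> = diag_matrix d"
    using Q by (simp add: orthogonal_matrix_def)
  finally have "spd (diag_matrix d)"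
    using spd_congruence[OF assms, of Q] Q
    by (metis invertible_def orthogonal_matrix_def)
  then have "axis i 1 \<bullet> (diag_matrix d *v axis i 1) > 0" for i
    by (simp add: spd_def axis_eq_0_iff)
  moreover have "axis i 1 \<bullet> (diag_matrix d *v axis i 1) = d i" for i
    by (simp add: inner_axis' matrix_vector_mult_basis column_def diag_matrix_def)
  ultimately have "d i > 0" for i by metis
  with Q A that show ?thesis by blast
qed

section \<open>Log-determinant and trace inequalities\<close>

lemma trace_conj_orthogonal:
  fixes Q :: "real ^ 'n ^ 'n"
  assumes "orthogonal_matrix Q"
  shows "trace (Q ** D ** transpose Q) = trace D"
  using assms by (metis matrix_mul_assoc matrix_mul_lid orthogonal_matrix_def trace_mul_sym)

lemma det_conj_orthogonal:
  fixes Q :: "real ^ 'n ^ 'n"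
  assumes "orthogonal_matrix Q"
  shows "det (Q ** D ** transpose Q) = det D"
proof -
  have "det (Q ** D ** transpose Q) = det (transpose Q ** Q) * det D"
    by (simp add: det_mul)
  then show ?thesis using assms by (simp add: orthogonal_matrix_def)
qed

lemma spd_det_pos:
  fixes A :: "real ^ 'n ^ 'n"
  assumes "spd A"
  shows "det A > 0"
proof -
  obtain Q d where "orthogonal_matrix Q" "A = Q ** diag_matrix d ** transpose Q" "\<And>i. d i > 0"
    using spd_diagonalization[OF assms] by blast
  then show ?thesis by (simp add: det_conj_orthogonal det_diag_matrix prod_pos)
qed

lemma spd_invertible:
  fixes A :: "real ^ 'n ^ 'n"
  shows "spd A \<Longrightarrow> invertible A"
  using spd_det_pos[of A] by (simp add: invertible_det_nz)

text \<open>Determinant and trace are the product and sum of the eigenvalues, so the bound is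
  \<open>ln d \<le> d - 1\<close> summed over them.\<close>

lemma spd_ln_det_le_trace:
  fixes A :: "real ^ 'n ^ 'n"
  assumes "spd A"
  shows "ln (det A) \<le> trace A - real CARD('n)"
proof -
  obtain Q d where Q: "orthogonal_matrix Q" "A = Q ** diag_matrix d ** transpose Q"
    and d: "\<And>i. d i > 0"
    using spd_diagonalization[OF assms] by blast
  have "ln (det A) = (\<Sum>i\<in>UNIV. ln (d i))"
    using d by (simp add: Q det_conj_orthogonal det_diag_matrix ln_prod less_imp_neq[symmetric])
  also have "\<dots> \<le> (\<Sum>i\<in>UNIV. d i - 1)"
    using d by (intro sum_mono ln_le_minus_one)
  also have "\<dots> = trace A - real CARD('n)"
    by (simp add: Q trace_conj_orthogonal trace_diag_matrix sum_subtractf)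
  finally show ?thesis .
qed

text \<open>Scaling the columns of \<open>Q\<close> by the square roots of the eigenvalues gives
  \<open>R\<close>.\<close>

lemma spd_factorization:
  fixes A :: "real ^ 'n ^ 'n"
  assumes "spd A"
  obtains R :: "real ^ 'n ^ 'n" where "invertible R" "A = R ** transpose R"
proof -
  obtain Q :: "real ^ 'n ^ 'n" and d
    where Q: "A = Q ** diag_matrix d ** transpose Q" and d: "\<And>i. d i > 0"
    using spd_diagonalization[OF assms] by blast
  define R where "R = Q ** diag_matrix (\<lambda>i. sqrt (d i))"
  have "R ** transpose R =
      Q ** (diag_matrix (\<lambda>i. sqrt (d i)) ** diag_matrix (\<lambda>i. sqrt (d i))) ** transpose Q"
    by (simp add: R_def matrix_transpose_mul matrix_mul_assoc)
  then have A: "A = R ** transpose R"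
    using d by (simp add: Q diag_matrix_mult less_imp_le)
  then have "det R \<noteq> 0" using spd_det_pos[OF assms] by (auto simp: det_mul)
  then show ?thesis using that[OF _ A] by (simp add: invertible_det_nz)
qed

text \<open>The product \<open>A ** B\<close> need not be symmetric. Writing
  \<open>A = R ** transpose R\<close> and moving \<open>R\<close> cyclically gives the positive
  definite \<open>?C\<close> with the same determinant and trace.\<close>

lemma spd_ln_det_mult_le_trace:
  fixes A B :: "real ^ 'n ^ 'n"
  assumes "spd A" "spd B"
  shows "ln (det (A ** B)) \<le> trace (A ** B) - real CARD('n)"
proof -
  obtain R :: "real ^ 'n ^ 'n" where R: "invertible R" "A = R ** transpose R"
    using spd_factorization[OF assms(1)] by blast
  let ?C = "transpose R ** B ** R"
  have "det ?C = det (A ** B)" by (simp add: R(2) det_mul)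
  moreover have "trace ?C = trace (A ** B)"
    by (metis R(2) matrix_mul_assoc trace_mul_sym)
  ultimately show ?thesis
    using spd_ln_det_le_trace[OF spd_congruence[OF assms(2) R(1)]] by simp
qed

text \<open>The inverse is itself a congruence of \<open>A\<close>: with \<open>?X\<close>
  symmetric, \<open>transpose ?X ** A ** ?X = ?X\<close>.\<close>

lemma spd_matrix_inv:
  fixes A :: "real ^ 'n ^ 'n"
  assumes "spd A"
  shows "spd (matrix_inv A)"
proof -
  let ?X = "matrix_inv A"
  have A: "transpose A = A" and I: "A ** ?X = mat 1" "?X ** A = mat 1"
    using assms matrix_inv_mult[OF spd_invertible] by (auto simp: spd_def)
  have "A ** transpose ?X = mat 1"
    by (metis A I(2) matrix_transpose_mul transpose_mat)
  then have "transpose ?X = ?X" by (metis matrix_inv_unique)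
  then have "transpose ?X ** A ** ?X = ?X" by (simp add: I)
  moreover have "invertible ?X" using I unfolding invertible_def by blast
  ultimately show ?thesis using spd_congruence[OF assms, of ?X] by simp
qed

section \<open>The BFGS update\<close>

lemma outer_prod_nth: "outer_prod u v $ i $ j = u $ i * v $ j"
  by (simp add: outer_prod_def matrix_matrix_mult_def columnvector_def rowvector_def)

lemma outer_prod_mult_vector: "outer_prod u v *v x = (v \<bullet> x) *\<^sub>R u"
  by (simp add: vec_eq_iff matrix_vector_mult_def outer_prod_nth inner_vec_def sum_distrib_left
      sum_distrib_right mult_ac)

lemma transpose_outer_prod: "transpose (outer_prod u v) = outer_prod v u"
  by (simp add: vec_eq_iff transpose_def outer_prod_nth)

lemma transpose_add: "transpose (A + B) = transpose A + transpose B"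
  by (simp add: vec_eq_iff transpose_def)

lemma matrix_add_rdistrib:
  fixes A B :: "'a::semiring_1 ^ 'n ^ 'm"
  shows "(A + B) ** C = A ** C + B ** C"
  by (simp add: vec_eq_iff matrix_matrix_mult_def sum.distrib distrib_right)

lemma bfgs_inverse_mult_vector:
  "bfgs_inverse B y s *v x =
    transpose (mat 1 - (1 / (y \<bullet> s)) *\<^sub>R outer_prod y s) *v
      (matrix_inv B *v (x - ((s \<bullet> x) / (y \<bullet> s)) *\<^sub>R y)) + ((s \<bullet> x) / (y \<bullet> s)) *\<^sub>R s"
  by (simp add: bfgs_inverse_def matrix_vector_mult_add_rdistrib matrix_vector_mul_assoc[symmetric]
      matrix_vector_mult_diff_rdistrib scaleR_matrix_vector_assoc[symmetric]
      outer_prod_mult_vector del: transpose_matrix_vector)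

text \<open>At \<open>x = y\<close> the projected argument
  \<open>x - ((s \<bullet> x) / (y \<bullet> s)) *\<^sub>R y\<close> is zero, and only the rank-one
  term survives.\<close>

lemma bfgs_inverse_secant:
  assumes "y \<bullet> s \<noteq> 0"
  shows "bfgs_inverse B y s *v y = s"
  unfolding bfgs_inverse_mult_vector using assms
  by (simp add: inner_commute del: transpose_matrix_vector)

text \<open>The quadratic form is a sum of two nonnegative terms that cannot vanish together for
  nonzero \<open>x\<close>.\<close>

lemma spd_bfgs_inverse:
  fixes B :: "real ^ 'n ^ 'n"
  assumes "spd B" "y \<bullet> s > 0"
  shows "spd (bfgs_inverse B y s)"
proof -
  define W where "W = mat 1 - (1 / (y \<bullet> s)) *\<^sub>R outer_prod y s"
  define H where "H = matrix_inv B"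
  have H: "spd H" using spd_matrix_inv[OF assms(1)] by (simp add: H_def)
  have eq: "bfgs_inverse B y s = transpose W ** H ** W + (1 / (y \<bullet> s)) *\<^sub>R outer_prod s s"
    by (simp add: bfgs_inverse_def W_def H_def)
  have "transpose (bfgs_inverse B y s) = bfgs_inverse B y s"
    using H by (simp add: eq spd_def transpose_add transpose_scalar transpose_outer_prod
        matrix_transpose_mul matrix_mul_assoc)
  moreover have "x \<bullet> (bfgs_inverse B y s *v x) > 0" if "x \<noteq> 0" for x
  proof -
    have Wx: "W *v x = x - ((s \<bullet> x) / (y \<bullet> s)) *\<^sub>R y"
      by (simp add: W_def matrix_vector_mult_diff_rdistrib scaleR_matrix_vector_assoc[symmetric]
          outer_prod_mult_vector)
    have val: "x \<bullet> (bfgs_inverse B y s *v x) =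
        (W *v x) \<bullet> (H *v (W *v x)) + (s \<bullet> x)^2 / (y \<bullet> s)"
      by (simp add: eq matrix_vector_mult_add_rdistrib inner_right_distrib
          inner_congruence scaleR_matrix_vector_assoc[symmetric] outer_prod_mult_vector power2_eq_square inner_commute)
    show ?thesis
    proof (cases "W *v x = 0")
      case True
      \<comment> \<open>Here \<open>x\<close> equals
        \<open>(s \<bullet> x) / (y \<bullet> s)\<close> times \<open>y\<close>, so
        \<open>s \<bullet> x = 0\<close> would force \<open>x = 0\<close>.\<close>
      then have "s \<bullet> x \<noteq> 0" using Wx that by auto
      then show ?thesis using val True assms(2) by simp
    next
      case False
      then have "(W *v x) \<bullet> (H *v (W *v x)) > 0" using H by (simp add: spd_def)
      moreover have "(s \<bullet> x)^2 / (y \<bullet> s) \<ge> 0" using assms(2) by simp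
      ultimately show ?thesis using val by simp
    qed
  qed
  ultimately show ?thesis by (simp add: spd_def)
qed

text \<open>First-order optimality: the gradient difference is orthogonal to the feasible directions.\<close>

lemma trace_bfgs_inverse_mult:
  fixes B D :: "real ^ 'n ^ 'n"
  assumes sym: "transpose D = D" and Ds: "D *v s = 0"
  shows "trace (bfgs_inverse B y s ** D) = trace (matrix_inv B ** D)"
proof -
  define W where "W = mat 1 - (1 / (y \<bullet> s)) *\<^sub>R outer_prod y s"
  have sD: "s \<bullet> (D *v x) = 0" for x
    using inner_symmetric_matrix[OF sym, of s x] Ds by simp
  have WD: "W ** D = D"
    by (simp add: matrix_eq W_def matrix_vector_mult_diff_rdistrib matrix_vector_mul_assoc[symmetric]
        scaleR_matrix_vector_assoc[symmetric] outer_prod_mult_vector sD)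
  then have DW: "D ** transpose W = D" by (metis matrix_transpose_mul sym)
  have "((1 / (y \<bullet> s)) *\<^sub>R outer_prod s s) ** D = 0"
    by (simp add: matrix_eq matrix_vector_mul_assoc[symmetric]
        scaleR_matrix_vector_assoc[symmetric] outer_prod_mult_vector sD)
  then have "bfgs_inverse B y s ** D = transpose W ** matrix_inv B ** (W ** D)"
    by (simp add: bfgs_inverse_def W_def matrix_add_rdistrib matrix_mul_assoc)
  also have "\<dots> = transpose W ** (matrix_inv B ** D)"
    by (simp add: WD matrix_mul_assoc)
  \<comment> \<open>Cyclicity of the trace carries \<open>transpose W\<close> to the right of
    \<open>D\<close>, which absorbs it.\<close>
  finally have "trace (bfgs_inverse B y s ** D) = trace (matrix_inv B ** D ** transpose W)"
    by (simp only: trace_mul_sym[of "transpose W"])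
  also have "\<dots> = trace (matrix_inv B ** (D ** transpose W))"
    by (simp only: matrix_mul_assoc)
  finally show ?thesis by (simp add: DW)
qed

section \<open>Relative entropy and optimality of the update\<close>

lemma gauss_rel_entropy_spd:
  fixes P Q :: "real ^ 'n ^ 'n"
  assumes "spd P" "spd Q"
  shows "gauss_rel_entropy P Q =
    1 / 2 * (ln (det Q) - ln (det P) + trace (matrix_inv Q ** P) - real CARD('n))"
proof -
  have "det P * det (matrix_inv P) = 1"
    by (metis assms(1) det_I det_mul matrix_inv_mult(1) spd_invertible)
  then have "det (matrix_inv P) = 1 / det P"
    using spd_det_pos[OF assms(1)] by (simp add: field_simps)
  then have "ln (det (matrix_inv P ** Q)) = ln (det Q) - ln (det P)"
    using spd_det_pos[OF assms(1)] spd_det_pos[OF assms(2)] by (simp add: det_mul ln_div)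
  then show ?thesis by (simp add: gauss_rel_entropy_def)
qed

text \<open>The update formula specifies \<open>B'\<close> through its inverse;
  \<open>invertible B'\<close> ensures that \<open>matrix_inv B'\<close> is a genuine inverse. The
  witness is the inverse of the formula.\<close>

theorem corollary3p1:
  fixes B\<^sub>k :: "real ^ 'n ^ 'n" and y\<^sub>k s\<^sub>k :: "real ^ 'n"
  assumes "spd B\<^sub>k" and "y\<^sub>k \<bullet> s\<^sub>k > 0"
  shows "\<exists>B'. invertible B' \<and> matrix_inv B' = bfgs_inverse B\<^sub>k y\<^sub>k s\<^sub>k \<and>
           is_arg_min (\<lambda>B. gauss_rel_entropy B B\<^sub>k)
             (\<lambda>B. spd B \<and> matrix_inv B *v y\<^sub>k = s\<^sub>k) B'"
proof -
  define X where "X = bfgs_inverse B\<^sub>k y\<^sub>k s\<^sub>k"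
  define B' where "B' = matrix_inv X"
  have X: "spd X" using spd_bfgs_inverse[OF assms] by (simp add: X_def)
  have B': "spd B'" using spd_matrix_inv[OF X] by (simp add: B'_def)
  have XB': "X ** B' = mat 1" "B' ** X = mat 1"
    using matrix_inv_mult[OF spd_invertible[OF X]] by (auto simp: B'_def)
  have inv: "matrix_inv B' = X" using XB' by (simp add: matrix_inv_unique)
  have Xy: "X *v y\<^sub>k = s\<^sub>k" using assms(2) by (simp add: X_def bfgs_inverse_secant)
  \<comment> \<open>Multiplying the constraint by \<open>B\<close> makes it linear in
    \<open>B\<close>, so differences of feasible points annihilate \<open>s\<^sub>k\<close>.\<close>
  have secant: "B *v s\<^sub>k = y\<^sub>k" if "spd B" "matrix_inv B *v y\<^sub>k = s\<^sub>k" for B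
    using matrix_inv_mult(1)[OF spd_invertible[OF that(1)]] that(2)
    by (metis matrix_vector_mul_assoc matrix_vector_mul_lid)
  have "gauss_rel_entropy B' B\<^sub>k \<le> gauss_rel_entropy B B\<^sub>k"
    if B: "spd B" "matrix_inv B *v y\<^sub>k = s\<^sub>k" for B
  proof -
    define D where "D = B - B'"
    have BD: "B = B' + D" by (simp add: D_def)
    have "transpose D = D"
      using B B' by (simp add: D_def spd_def transpose_def vec_eq_iff)
    moreover have "D *v s\<^sub>k = 0"
      using secant[OF B] secant[OF B'] inv Xy
      by (simp add: D_def matrix_vector_mult_diff_rdistrib)
    ultimately have tr: "trace (X ** D) = trace (matrix_inv B\<^sub>k ** D)"
      unfolding X_def by (rule trace_bfgs_inverse_mult)
    have "det X * det B' = 1" using XB'(1) by (metis det_I det_mul)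
    then have detX: "det X = 1 / det B'"
      using spd_det_pos[OF B'] by (simp add: field_simps)
    have "ln (det B) - ln (det B') = ln (det (X ** B))"
      using spd_det_pos[OF B(1)] spd_det_pos[OF B'] by (simp add: det_mul detX ln_div)
    also have "\<dots> \<le> trace (X ** B) - real CARD('n)"
      by (rule spd_ln_det_mult_le_trace[OF X B(1)])
    \<comment> \<open>Since \<open>X ** B = mat 1 + X ** D\<close>, the trace of the identity
      cancels the dimension.\<close>
    also have "\<dots> = trace (X ** D)"
      by (simp add: BD matrix_add_ldistrib trace_add XB' trace_I)
    also have "\<dots> = trace (matrix_inv B\<^sub>k ** B) - trace (matrix_inv B\<^sub>k ** B')"
      by (simp add: tr BD matrix_add_ldistrib trace_add)
    finally show ?thesis
      by (simp add: gauss_rel_entropy_spd B B' assms(1))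
  qed
  then have "is_arg_min (\<lambda>B. gauss_rel_entropy B B\<^sub>k)
      (\<lambda>B. spd B \<and> matrix_inv B *v y\<^sub>k = s\<^sub>k) B'"
    using B' inv Xy by (simp add: is_arg_min_linorder)
  then show ?thesis using spd_invertible[OF B'] inv by (auto simp: X_def)
qed

end
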